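(* Let $G=(V,E)$ be a directed acyclic graph with $m=|E|$ edges and terminals $s,t\in V$, in which every edge fails independently with the same probability $\overline p=1-\overline q$, where $0<\overline q\le 1$, and assume $G$ contains at least one directed $s$-$t$ path. Let $\mu$ be an edge-vertex bound of $G$, and let $l_{\min}$ and $l_{\max}$ be the minimal and maximal number of edges of an $s$-$t$ path in $G$. Let $\mathcal P$ be the set of $s$-$t$ paths in $G$, $w(\Omega)=\sum_{\gamma\in\mathcal P}\overline q^{|\gamma|}$ (the expected number of intact $s$-$t$ paths), and $w(A)=\mathit{REL}_{s,t}(G)$ (the probability that at least one $s$-$t$ path has all its edges intact). Then $$\frac{w(\Omega)}{w(A)}\leq\min\left\{\left(\frac{2}{2-\overline q}\right)^{m-l_{\min}},\;2^{1+\frac{\mu}{m}\left[(\overline q m+\ln 2)(\overline q m+\ln 2+l_{\max})\right]}\right\}.$$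
   Context: A graph $G=(V,E)$ has edge-vertex bound $\mu$ if for every subset $U\subseteq V$ the subgraph of $G$ induced by $U$ has at most $\mu|U|$ edges. *)

theory Defs
  imports "Graph_Theory.Graph_Theory" "HOL-Probability.Probability"
begin

text \<open>Arcs are abstract objects with a tail and a head, so parallel arcs are permitted.
  The library notion of a cycle includes loops.\<close>

definition acyclic_digraph :: "('a, 'b) pre_digraph \<Rightarrow> bool" where
  "acyclic_digraph G \<longleftrightarrow> (\<nexists>p. pre_digraph.cycle G p)"

definition edge_vertex_bound :: "('a, 'b) pre_digraph \<Rightarrow> real \<Rightarrow> bool" where
  "edge_vertex_bound G \<mu> \<longleftrightarrow>
     (\<forall>U \<subseteq> verts G. real (card (arcs (G \<restriction> U))) \<le> \<mu> * real (card U))"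

text \<open>A path is the list of its arcs. The vertices it visits are distinct, and the empty list
  is the only path from a vertex to itself.\<close>

definition st_paths :: "('a, 'b) pre_digraph \<Rightarrow> 'a \<Rightarrow> 'a \<Rightarrow> 'b list set" where
  "st_paths G s t = {p. pre_digraph.apath G s p t}"

definition min_path_length :: "('a, 'b) pre_digraph \<Rightarrow> 'a \<Rightarrow> 'a \<Rightarrow> nat" where
  "min_path_length G s t = Min (length ` st_paths G s t)"

definition max_path_length :: "('a, 'b) pre_digraph \<Rightarrow> 'a \<Rightarrow> 'a \<Rightarrow> nat" where
  "max_path_length G s t = Max (length ` st_paths G s t)"

text \<open>The random state of the network: \<open>\<omega> e\<close> says that \<open>e\<close> is intact, which holds with
  probability \<open>q\<close>, independently for all arcs.\<close>

definition network_pmf :: "('a, 'b) pre_digraph \<Rightarrow> real \<Rightarrow> ('b \<Rightarrow> bool) pmf" where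
  "network_pmf G q = Pi_pmf (arcs G) False (\<lambda>_. bernoulli_pmf q)"

definition reliability :: "('a, 'b) pre_digraph \<Rightarrow> real \<Rightarrow> 'a \<Rightarrow> 'a \<Rightarrow> real" where
  "reliability G q s t =
     measure_pmf.prob (network_pmf G q) {\<omega>. \<exists>p \<in> st_paths G s t. \<forall>e \<in> set p. \<omega> e}"

definition path_weight :: "('a, 'b) pre_digraph \<Rightarrow> real \<Rightarrow> 'a \<Rightarrow> 'a \<Rightarrow> real" where
  "path_weight G q s t = (\<Sum>p \<in> st_paths G s t. q ^ length p)"

end

theory Submission
  imports Defs
begin

text \<open>Let \<open>N(S)\<close> be the number of paths inside the arc set \<open>S\<close>. Splitting each state among its
  intact paths gives \<open>w(A) = (\<Sum>p. q ^ |p| * E (1 / N(p \<union> T)))\<close>, where the random set \<open>T\<close> contains each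
  arc outside \<open>p\<close> independently with probability \<open>q\<close>. It suffices to bound each of these means below.

  Where two paths in \<open>p \<union> T\<close> first diverge, at least one of the two arcs is outside \<open>p\<close>. Its
  ends lie on \<open>p\<close> or are tails of other arcs of \<open>T\<close>. Paths are therefore determined by their
  intersection with the set \<open>B \<subseteq> T\<close> of such arcs, so \<open>N(p \<union> T) \<le> 2 ^ |B|\<close>. Using \<open>|B| \<le> |T|\<close>,
  the generating function of the binomial distribution gives the first bound. For the second,
  Jensen gives \<open>E (2 ^ - |B|) \<ge> 2 ^ - E |B|\<close>. Whether an arc is in \<open>T\<close> is independent of whether its
  ends are hit by the others, so the edge-vertex bound applied to the at most \<open>|p| + 1 + |T|\<close>
  vertices hit gives \<open>E |B| \<le> q * \<mu> * (|p| + 1 + q * m)\<close>.\<close>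

section \<open>Means over random subsets of a finite set\<close>

text \<open>The expectation is kept as a finite sum, so that induction on \<open>A\<close> takes the
  place of measure theory.\<close>

definition subset_mean :: "real \<Rightarrow> 'b set \<Rightarrow> ('b set \<Rightarrow> real) \<Rightarrow> real" where
  "subset_mean q A f = (\<Sum>T\<in>Pow A. q ^ card T * (1 - q) ^ card (A - T) * f T)"

lemma subset_mean_empty [simp]: "subset_mean q {} f = f {}"
  by (simp add: subset_mean_def)

text \<open>Conditioning on whether \<open>e\<close> is drawn; the inductions on \<open>A\<close>
  below run on this recursion.\<close>

lemma subset_mean_insert:
  assumes "finite A" "e \<notin> A"
  shows "subset_mean q (insert e A) f
    = q * subset_mean q A (\<lambda>T. f (insert e T)) + (1 - q) * subset_mean q A f"
proof -
  let ?g = "\<lambda>T. q ^ card T * (1 - q) ^ card (insert e A - T) * f T"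
  have "subset_mean q (insert e A) f = sum ?g (Pow A) + sum ?g (insert e ` Pow A)"
    unfolding subset_mean_def Pow_insert
    by (rule sum.union_disjoint) (use assms in auto)
  also have "sum ?g (Pow A) = (1 - q) * subset_mean q A f"
    unfolding subset_mean_def sum_distrib_left
  proof (rule sum.cong)
    fix T assume "T \<in> Pow A"
    then have "insert e A - T = insert e (A - T)" using assms by auto
    then show "?g T = (1 - q) * (q ^ card T * (1 - q) ^ card (A - T) * f T)"
      using assms by simp
  qed simp
  also have "sum ?g (insert e ` Pow A) = sum (?g \<circ> insert e) (Pow A)"
    by (rule sum.reindex) (use assms in \<open>auto simp: inj_on_def\<close>)
  also have "\<dots> = q * subset_mean q A (\<lambda>T. f (insert e T))"
    unfolding subset_mean_def sum_distrib_left
  proof (rule sum.cong)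
    fix T assume T: "T \<in> Pow A"
    then have "insert e A - insert e T = A - T" "e \<notin> T" "finite T"
      using assms finite_subset by auto
    then show "(?g \<circ> insert e) T
        = q * (q ^ card T * (1 - q) ^ card (A - T) * f (insert e T))"
      by simp
  qed simp
  finally show ?thesis by simp
qed

lemma subset_mean_mono:
  assumes "0 \<le> q" "q \<le> 1" "\<And>T. T \<subseteq> A \<Longrightarrow> f T \<le> g T"
  shows "subset_mean q A f \<le> subset_mean q A g"
  unfolding subset_mean_def by (intro sum_mono mult_left_mono) (use assms in auto)

lemma subset_mean_add:
  "subset_mean q A (\<lambda>T. f T + g T) = subset_mean q A f + subset_mean q A g"
  by (simp add: subset_mean_def sum.distrib algebra_simps)

lemma subset_mean_cmult: "subset_mean q A (\<lambda>T. c * f T) = c * subset_mean q A f"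
  by (simp add: subset_mean_def sum_distrib_left algebra_simps)

lemma subset_mean_sum:
  "subset_mean q A (\<lambda>T. \<Sum>i\<in>I. f i T) = (\<Sum>i\<in>I. subset_mean q A (f i))"
proof -
  have "subset_mean q A (\<lambda>T. \<Sum>i\<in>I. f i T)
      = (\<Sum>T\<in>Pow A. \<Sum>i\<in>I. q ^ card T * (1 - q) ^ card (A - T) * f i T)"
    by (simp add: subset_mean_def sum_distrib_left)
  also have "\<dots> = (\<Sum>i\<in>I. subset_mean q A (f i))"
    unfolding subset_mean_def by (rule sum.swap)
  finally show ?thesis .
qed

lemma subset_mean_cong:
  "(\<And>T. T \<subseteq> A \<Longrightarrow> f T = g T) \<Longrightarrow> subset_mean q A f = subset_mean q A g"
  unfolding subset_mean_def by (rule sum.cong) auto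

lemma subset_mean_const:
  assumes "finite A"
  shows "subset_mean q A (\<lambda>_. c) = c"
  using assms by (induction A) (auto simp: subset_mean_insert algebra_simps)

lemma subset_mean_power_card:
  assumes "finite A"
  shows "subset_mean q A (\<lambda>T. c ^ card T) = (1 - q + q * c) ^ card A"
  using assms
proof (induction A)
  case (insert e A)
  have "subset_mean q A (\<lambda>T. c ^ card (insert e T)) = subset_mean q A (\<lambda>T. c * c ^ card T)"
  proof (rule subset_mean_cong)
    fix T assume "T \<subseteq> A"
    then have "e \<notin> T" "finite T" using insert.hyps finite_subset by auto
    then show "c ^ card (insert e T) = c * c ^ card T" by simp
  qed
  then show ?case
    using insert by (simp add: subset_mean_insert subset_mean_cmult algebra_simps)
qed simp

lemma subset_mean_card:
  assumes "finite A"
  shows "subset_mean q A (\<lambda>T. real (card T)) = q * real (card A)"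
  using assms
proof (induction A)
  case (insert e A)
  have "subset_mean q A (\<lambda>T. real (card (insert e T)))
      = subset_mean q A (\<lambda>T. 1 + real (card T))"
  proof (rule subset_mean_cong)
    fix T assume "T \<subseteq> A"
    then have "e \<notin> T" "finite T" using insert.hyps finite_subset by auto
    then show "real (card (insert e T)) = 1 + real (card T)" by simp
  qed
  then show ?case
    using insert
    by (simp add: subset_mean_insert subset_mean_add subset_mean_const algebra_simps)
qed simp

text \<open>All of \<open>C\<close> is drawn with probability \<open>q ^ card C\<close>, and the
  other elements are independent of that event. This passes between a mean given an intact path and
  a mean over all states.\<close>

lemma subset_mean_superset:
  assumes "finite A" "C \<subseteq> A"
  shows "subset_mean q A (\<lambda>S. of_bool (C \<subseteq> S) * f S)
    = q ^ card C * subset_mean q (A - C) (\<lambda>T. f (C \<union> T))"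
proof -
  let ?w = "\<lambda>S. q ^ card S * (1 - q) ^ card (A - S) * f S"
  have "subset_mean q A (\<lambda>S. of_bool (C \<subseteq> S) * f S) = sum ?w {S \<in> Pow A. C \<subseteq> S}"
    unfolding subset_mean_def
    by (rule sum.mono_neutral_cong_right) (use assms in auto)
  also have "\<dots> = (\<Sum>T\<in>Pow (A - C). ?w (C \<union> T))"
    by (rule sum.reindex_bij_witness[where i="\<lambda>T. C \<union> T" and j="\<lambda>S. S - C"])
      (use assms in \<open>auto simp: Un_absorb1\<close>)
  also have "\<dots> = q ^ card C * subset_mean q (A - C) (\<lambda>T. f (C \<union> T))"
    unfolding subset_mean_def sum_distrib_left
  proof (rule sum.cong)
    fix T assume T: "T \<in> Pow (A - C)"
    then have "card (C \<union> T) = card C + card T"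
      using assms by (intro card_Un_disjoint) (auto intro: finite_subset)
    moreover have "A - (C \<union> T) = A - C - T" by auto
    ultimately show "?w (C \<union> T)
        = q ^ card C * (q ^ card T * (1 - q) ^ card (A - C - T) * f (C \<union> T))"
      by (simp add: power_add)
  qed simp
  finally show ?thesis .
qed

text \<open>Whether \<open>e\<close> is in \<open>T\<close> is independent of
  \<open>T - {e}\<close>, so the mean of each indicator factors; monotonicity then lets
  \<open>T - {e}\<close> grow to \<open>T\<close>. The count on the right ranges over all of
  \<open>A\<close>, the form to which an edge-vertex bound applies.\<close>

lemma subset_mean_card_independent:
  assumes "finite A" "0 \<le> q" "q \<le> 1"
    and mono: "\<And>e T T'. T \<subseteq> T' \<Longrightarrow> Q e T \<Longrightarrow> Q e T'"
  shows "subset_mean q A (\<lambda>T. real (card {e \<in> T. Q e (T - {e})}))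
    \<le> q * subset_mean q A (\<lambda>T. real (card {e \<in> A. Q e T}))"
proof -
  have one: "subset_mean q A (\<lambda>T. of_bool (e \<in> T \<and> Q e (T - {e})))
      \<le> q * subset_mean q A (\<lambda>T. of_bool (Q e T))" if "e \<in> A" for e
  proof -
    define B where "B = A - {e}"
    have B: "A = insert e B" "e \<notin> B" "finite B" using that assms by (auto simp: B_def)
    let ?m = "subset_mean q B (\<lambda>T. of_bool (Q e T))"
    have "subset_mean q A (\<lambda>T. of_bool (e \<in> T \<and> Q e (T - {e})))
        = q * subset_mean q B (\<lambda>T. of_bool (Q e (insert e T - {e})))
          + (1 - q) * subset_mean q B (\<lambda>T. of_bool (e \<in> T \<and> Q e (T - {e})))"
      using B by (simp add: subset_mean_insert)
    also have "subset_mean q B (\<lambda>T. of_bool (e \<in> T \<and> Q e (T - {e}))) = subset_mean q B (\<lambda>_. 0)"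
      using B(2) by (intro subset_mean_cong) auto
    also have "subset_mean q B (\<lambda>T. of_bool (Q e (insert e T - {e}))) = ?m"
      using B(2) by (intro subset_mean_cong) (metis Diff_insert_absorb subsetD)
    also have "q * ?m + (1 - q) * subset_mean q B (\<lambda>_. 0) = q * ?m"
      using B(3) by (simp add: subset_mean_const)
    also have "?m \<le> subset_mean q A (\<lambda>T. of_bool (Q e T))"
    proof -
      have "?m \<le> subset_mean q B (\<lambda>T. of_bool (Q e (insert e T)))"
        by (intro subset_mean_mono assms) (simp add: of_bool_def mono[OF subset_insertI])
      \<comment> \<open>The left side is \<open>?m\<close>, split by the state of \<open>e\<close>
        to match the recursion for \<open>A\<close>; only the branch with \<open>e\<close> drawn can
        grow.\<close>
      then have "q * ?m + (1 - q) * ?m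
          \<le> q * subset_mean q B (\<lambda>T. of_bool (Q e (insert e T))) + (1 - q) * ?m"
        using assms by (intro add_right_mono mult_left_mono)
      then show ?thesis using B by (simp add: subset_mean_insert algebra_simps)
    qed
    finally show ?thesis using assms by (simp add: mult_left_mono)
  qed
  have "subset_mean q A (\<lambda>T. real (card {e \<in> T. Q e (T - {e})}))
      = subset_mean q A (\<lambda>T. \<Sum>e\<in>A. of_bool (e \<in> T \<and> Q e (T - {e})))"
  proof (rule subset_mean_cong)
    fix T assume "T \<subseteq> A"
    then have "A \<inter> {e. e \<in> T \<and> Q e (T - {e})} = {e \<in> T. Q e (T - {e})}" by auto
    then show "real (card {e \<in> T. Q e (T - {e})}) = (\<Sum>e\<in>A. of_bool (e \<in> T \<and> Q e (T - {e})))"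
      using assms by (simp add: sum_of_bool_eq)
  qed
  also have "\<dots> = (\<Sum>e\<in>A. subset_mean q A (\<lambda>T. of_bool (e \<in> T \<and> Q e (T - {e}))))"
    by (rule subset_mean_sum)
  also have "\<dots> \<le> (\<Sum>e\<in>A. q * subset_mean q A (\<lambda>T. of_bool (Q e T)))"
    by (intro sum_mono one)
  also have "\<dots> = q * subset_mean q A (\<lambda>T. \<Sum>e\<in>A. of_bool (Q e T))"
    by (simp add: subset_mean_sum sum_distrib_left)
  also have "subset_mean q A (\<lambda>T. \<Sum>e\<in>A. of_bool (Q e T))
      = subset_mean q A (\<lambda>T. real (card {e \<in> A. Q e T}))"
    using assms by (simp add: sum_of_bool_eq Collect_conj_eq)
  finally show ?thesis .
qed

text \<open>The product distribution lives on the finitely many states with default value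
  \<open>False\<close> off \<open>A\<close>, and these correspond to the subsets of
  \<open>A\<close>.\<close>

lemma prob_bernoulli_product_eq_subset_mean:
  assumes "finite A" "0 \<le> q" "q \<le> 1"
  shows "measure_pmf.prob (Pi_pmf A False (\<lambda>_. bernoulli_pmf q)) {\<omega>. P \<omega>}
    = subset_mean q A (\<lambda>T. of_bool (P (\<lambda>e. e \<in> T)))"
proof -
  let ?M = "Pi_pmf A False (\<lambda>_. bernoulli_pmf q)"
  let ?D = "{f. \<forall>x. x \<notin> A \<longrightarrow> \<not> f x}"
  have D: "?D = (\<lambda>T e. e \<in> T) ` Pow A"
  proof
    show "?D \<subseteq> (\<lambda>T e. e \<in> T) ` Pow A"
    proof
      fix f assume "f \<in> ?D"
      then have "f = (\<lambda>e. e \<in> {x. f x})" "{x. f x} \<in> Pow A" by auto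
      then show "f \<in> (\<lambda>T e. e \<in> T) ` Pow A" by (rule image_eqI)
    qed
  qed auto
  have pmf: "pmf ?M (\<lambda>e. e \<in> T) = q ^ card T * (1 - q) ^ card (A - T)" if "T \<subseteq> A" for T
  proof -
    have "pmf ?M (\<lambda>e. e \<in> T) = (\<Prod>e\<in>A. if e \<in> T then q else 1 - q)"
      using that assms by (auto simp: pmf_Pi intro!: prod.cong)
    also have "\<dots> = q ^ card T * (1 - q) ^ card (A - T)"
      using that assms by (simp add: prod.If_cases Int_absorb1 Diff_eq)
    finally show ?thesis .
  qed
  have "finite ?D" unfolding D using assms by simp
  have "measure_pmf.prob ?M {\<omega>. P \<omega>} = measure_pmf.prob ?M ({\<omega>. P \<omega>} \<inter> ?D)"
    by (rule measure_prob_cong_0) (use assms in \<open>auto simp: pmf_Pi\<close>)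
  also have "\<dots> = sum (pmf ?M) ({\<omega>. P \<omega>} \<inter> ?D)"
    using \<open>finite ?D\<close> by (intro measure_measure_pmf_finite) simp
  also have "\<dots> = (\<Sum>\<omega>\<in>?D. pmf ?M \<omega> * of_bool (P \<omega>))"
    by (rule sum.mono_neutral_cong_left) (use \<open>finite ?D\<close> in auto)
  also have "\<dots> = (\<Sum>T\<in>Pow A. pmf ?M (\<lambda>e. e \<in> T) * of_bool (P (\<lambda>e. e \<in> T)))"
    unfolding D by (subst sum.reindex) (auto simp: inj_on_def fun_eq_iff)
  also have "\<dots> = subset_mean q A (\<lambda>T. of_bool (P (\<lambda>e. e \<in> T)))"
    unfolding subset_mean_def by (rule sum.cong) (auto simp: pmf)
  finally show ?thesis .
qed


text \<open>Jensen's inequality for the convex function \<open>2 powr (- x)\<close>: a tangent line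
  lies below it, and taking means commutes with affine functions.\<close>

lemma subset_mean_powr_ge:
  assumes "finite A" "0 \<le> q" "q \<le> 1"
  shows "2 powr (- subset_mean q A f) \<le> subset_mean q A (\<lambda>T. 2 powr (- f T))"
proof -
  define a where "a = subset_mean q A f"
  \<comment> \<open>The left side is the tangent at \<open>a\<close>; the inequality is
    \<open>1 + y \<le> exp y\<close> at \<open>y = ln 2 * (a - x)\<close>, scaled by
    \<open>2 powr (- a)\<close>.\<close>
  have tangent: "2 powr (- a) * (1 + ln 2 * a) + (- (2 powr (- a) * ln 2)) * x \<le> 2 powr (- x)"
    for x :: real
  proof -
    have "2 powr (- a) * (1 + ln 2 * (a - x)) \<le> 2 powr (- a) * exp (ln 2 * (a - x))"
      by (intro mult_left_mono exp_ge_add_one_self) auto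
    also have "exp (ln 2 * (a - x)) = 2 powr (a - x)"
      by (simp add: powr_def mult.commute)
    also have "2 powr (- a) * 2 powr (a - x) = 2 powr (- x)"
      by (simp flip: powr_add)
    finally show ?thesis by (simp add: algebra_simps)
  qed
  have "2 powr (- a) = 2 powr (- a) * (1 + ln 2 * a) + (- (2 powr (- a) * ln 2)) * a"
    by (simp add: algebra_simps)
  also have "\<dots> = subset_mean q A
      (\<lambda>T. 2 powr (- a) * (1 + ln 2 * a) + (- (2 powr (- a) * ln 2)) * f T)"
    using assms by (simp only: subset_mean_add subset_mean_cmult subset_mean_const a_def)
  also have "\<dots> \<le> subset_mean q A (\<lambda>T. 2 powr (- f T))"
    using assms by (intro subset_mean_mono tangent)
  finally show ?thesis by (simp add: a_def)
qed

section \<open>Paths encoded by their detour arcs\<close>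

text \<open>Follow both paths from their common start. The arcs at a first divergence share a tail,
  so one of them is in \<open>B\<close> and hence lies on both paths; but a path leaves each vertex
  at most once.\<close>

lemma (in wf_digraph) apath_eqI:
  assumes "apath u p v" "apath u p' v" "set p \<inter> B = set p' \<inter> B"
    and "\<And>e e'. \<lbrakk>e \<in> set p; e' \<in> set p'; tail G e = tail G e'; e \<noteq> e'\<rbrakk> \<Longrightarrow> e \<in> B \<or> e' \<in> B"
  shows "p = p'"
  using assms
proof (induction p arbitrary: u p')
  case Nil
  then have "u = v" by (simp add: apath_Nil_iff)
  then show ?case using apath_nonempty_ends[OF Nil.prems(2)] by blast
next
  case (Cons e r)
  have u: "tail G e = u" "apath (head G e) r v" "u \<notin> set (awalk_verts (head G e) r)"
    using Cons.prems(1) by (auto simp: apath_Cons_iff)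
  have "u \<noteq> v" using apath_nonempty_ends[OF Cons.prems(1)] by simp
  then obtain e' r' where p': "p' = e' # r'"
    using Cons.prems(2) by (cases p') (auto simp: apath_Nil_iff)
  have u': "tail G e' = u" "apath (head G e') r' v" "u \<notin> set (awalk_verts (head G e') r')"
    using Cons.prems(2) by (auto simp: p' apath_Cons_iff)
  \<comment> \<open>Neither remainder returns to \<open>u\<close>, so an arc leaving
    \<open>u\<close> can only be the first arc of its path.\<close>
  have off: "x \<notin> set r \<and> x \<notin> set r'" if "tail G x = u" for x
    using u(3) u'(3) that awalk_verts_arc1[of x r "head G e"] awalk_verts_arc1[of x r' "head G e'"]
    by auto
  note r = off[OF u(1)] off[OF u'(1)]
  have B: "x \<in> set (e # r) \<longleftrightarrow> x \<in> set (e' # r')" if "x \<in> B" for x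
    using Cons.prems(3) that unfolding p' by blast
  have "e = e'"
  proof (rule ccontr)
    assume ne: "e \<noteq> e'"
    then have "e \<in> B \<or> e' \<in> B"
      using Cons.prems(4)[of e e'] u(1) u'(1) p' by simp
    then show False using B[of e] B[of e'] r ne by auto
  qed
  moreover have "r = r'"
  proof (rule Cons.IH[OF u(2)])
    show "apath (head G e) r' v" using u'(2) \<open>e = e'\<close> by simp
    have "x \<in> set r \<longleftrightarrow> x \<in> set r'" if "x \<in> B" for x
      using B[OF that] r \<open>e = e'\<close> by (cases "x = e") auto
    then show "set r \<inter> B = set r' \<inter> B" by blast
    show "a \<in> B \<or> a' \<in> B"
      if "a \<in> set r" "a' \<in> set r'" "tail G a = tail G a'" "a \<noteq> a'" for a a'
      using Cons.prems(4)[of a a'] that by (simp add: p')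
  qed
  ultimately show ?case by (simp add: p')
qed

definition detour_arcs :: "('a, 'b) pre_digraph \<Rightarrow> 'a \<Rightarrow> 'b list \<Rightarrow> 'b set \<Rightarrow> 'b set" where
  "detour_arcs G s p T =
     {e \<in> T. {tail G e, head G e} \<subseteq> set (pre_digraph.awalk_verts G s p) \<union> tail G ` (T - {e})}"

lemma detour_arcs_subset: "detour_arcs G s p T \<subseteq> T"
  by (auto simp: detour_arcs_def)

text \<open>Every vertex of a path except its end is a tail; this brings heads into the form that
  \<open>detour_arcs\<close> asks for.\<close>

lemma (in wf_digraph) apath_head_cases:
  assumes "apath u p v" "e \<in> set p"
  obtains "head G e = v" | f where "f \<in> set p" "tail G f = head G e"
proof -
  have "head G e \<in> set (awalk_verts u p)"
    using assms by (intro awalk_verts_arc2) (auto simp: apath_def)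
  moreover have "p \<noteq> []" "head G (last p) = v"
    using assms by (auto simp: apath_def awalk_conv awalk_verts_conv split: if_splits)
  ultimately show ?thesis using that by (auto simp: awalk_verts_conv)
qed

lemma (in pre_digraph) distinct_tails_apath:
  "apath u p v \<Longrightarrow> distinct (map (tail G) p)"
  by (cases "p = []") (simp_all add: apath_def awalk_verts_conv)

text \<open>Intersecting with the detour arcs is injective on the paths inside \<open>S\<close>:
  where two of them diverge, an arc outside \<open>p\<close> is a detour arc.\<close>

lemma (in fin_digraph) card_apaths_le:
  assumes "p \<in> st_paths G s t" "finite S" "set p \<subseteq> S"
  shows "card {r \<in> st_paths G s t. set r \<subseteq> S} \<le> 2 ^ card (detour_arcs G s p (S - set p))"
proof -
  let ?T = "S - set p"
  let ?B = "detour_arcs G s p ?T"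
  have p: "apath s p t" using assms by (simp add: st_paths_def)
  have tails: "tail G e \<in> set (awalk_verts s p) \<union> tail G ` (?T - {e'})"
    if "e \<in> S" "e \<noteq> e'" for e e'
  proof (cases "e \<in> set p")
    case True
    then show ?thesis using awalk_verts_arc1[of e p s] by simp
  next
    case False
    with that have "e \<in> ?T - {e'}" by simp
    then show ?thesis by blast
  qed
  have t: "t \<in> set (awalk_verts s p)"
    using awalkI_apath[OF p] by (rule awalkE') (metis last_in_set awalk_verts_non_Nil)
  \<comment> \<open>The tail of \<open>e\<close> is located through the competing arc
    \<open>e'\<close>, its head through the next arc of \<open>r\<close> or the end
    \<open>t\<close>.\<close>
  have branch: "e \<in> ?B"
    if r: "apath s r t" "set r \<subseteq> S" "e \<in> set r" and e: "e \<notin> set p"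
      and e': "e' \<in> S" "tail G e' = tail G e" "e' \<noteq> e" for r e e'
  proof -
    have tl: "tail G e \<in> set (awalk_verts s p) \<union> tail G ` (?T - {e})"
      using tails[of e' e] e' by simp
    moreover have "head G e \<in> set (awalk_verts s p) \<union> tail G ` (?T - {e})"
      using r(1,3)
    proof (cases rule: apath_head_cases)
      case 1
      then show ?thesis using t by simp
    next
      case (2 f)
      show ?thesis
      proof (cases "f = e")
        case True
        then show ?thesis using 2 tl by simp
      next
        case False
        with tails[of f e] 2 r(2) show ?thesis by (simp add: subset_iff)
      qed
    qed
    moreover have "e \<in> ?T" using r e by blast
    ultimately show ?thesis by (simp add: detour_arcs_def)
  qed
  have "inj_on (\<lambda>r. set r \<inter> ?B) {r \<in> st_paths G s t. set r \<subseteq> S}"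
  proof (rule inj_onI)
    fix r r' assume *: "r \<in> {r \<in> st_paths G s t. set r \<subseteq> S}"
      "r' \<in> {r \<in> st_paths G s t. set r \<subseteq> S}" "set r \<inter> ?B = set r' \<inter> ?B"
    then have rr': "apath s r t" "apath s r' t" by (simp_all add: st_paths_def)
    show "r = r'"
    proof (rule apath_eqI[where B="?B"])
      fix e e' assume e: "e \<in> set r" "e' \<in> set r'" "tail G e = tail G e'" "e \<noteq> e'"
      \<comment> \<open>The path \<open>p\<close> leaves each vertex by at most one arc.\<close>
      have "e \<notin> set p \<or> e' \<notin> set p"
      proof (rule ccontr)
        assume "\<not> (e \<notin> set p \<or> e' \<notin> set p)"
        moreover have "inj_on (tail G) (set p)"
          using distinct_tails_apath[OF p] by (simp add: distinct_map)
        ultimately show False using e by (simp add: inj_on_def)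
      qed
      moreover have "set r \<subseteq> S" "set r' \<subseteq> S" using *(1,2) by simp_all
      ultimately show "e \<in> ?B \<or> e' \<in> ?B"
        using branch[OF rr'(1), of e e'] branch[OF rr'(2), of e' e] e by (metis subsetD)
    qed (use rr' *(3) in simp_all)
  qed
  moreover have "finite ?B"
    using assms(2) by (meson detour_arcs_subset finite_Diff finite_subset)
  ultimately have "card {r \<in> st_paths G s t. set r \<subseteq> S} \<le> card (Pow ?B)"
    by (intro card_inj_on_le) auto
  then show ?thesis using \<open>finite ?B\<close> by (simp add: card_Pow)
qed

section \<open>From path weight to reliability\<close>

lemma (in fin_digraph) finite_st_paths: "finite (st_paths G s t)"
  by (simp add: st_paths_def apaths_finite)

lemma (in fin_digraph) st_paths_arcs: "p \<in> st_paths G s t \<Longrightarrow> set p \<subseteq> arcs G"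
  by (auto simp: st_paths_def apath_def awalk_def)

lemma (in fin_digraph) card_set_st_path:
  "p \<in> st_paths G s t \<Longrightarrow> card (set p) = length p"
  using distinct_tails_apath by (simp add: st_paths_def distinct_map distinct_card)

text \<open>Each state with an intact path spreads mass 1 evenly over its intact paths, so summing
  over all paths recovers the reliability. The constant \<open>c\<close> is left open because both
  bounds of the theorem enter through it.\<close>

lemma (in fin_digraph) path_weight_le_reliability:
  assumes q: "0 \<le> q" "q \<le> 1"
    and c: "\<And>p. p \<in> st_paths G s t \<Longrightarrow>
      c \<le> subset_mean q (arcs G - set p) (\<lambda>T. (1 / 2) ^ card (detour_arcs G s p T))"
  shows "c * path_weight G q s t \<le> reliability G q s t"
proof -
  let ?P = "st_paths G s t"
  let ?N = "\<lambda>S. real (card {r \<in> ?P. set r \<subseteq> S})"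
  have "c * path_weight G q s t = (\<Sum>p\<in>?P. q ^ card (set p) * c)"
    unfolding path_weight_def sum_distrib_left
    by (rule sum.cong) (simp_all add: card_set_st_path)
  also have "\<dots> \<le> (\<Sum>p\<in>?P. q ^ card (set p)
      * subset_mean q (arcs G - set p) (\<lambda>T. 1 / ?N (set p \<union> T)))"
  proof (intro sum_mono mult_left_mono)
    fix p assume p: "p \<in> ?P"
    note c[OF p]
    also have "subset_mean q (arcs G - set p) (\<lambda>T. (1 / 2) ^ card (detour_arcs G s p T))
        \<le> subset_mean q (arcs G - set p) (\<lambda>T. 1 / ?N (set p \<union> T))"
    proof (rule subset_mean_mono[OF q])
      fix T assume T: "T \<subseteq> arcs G - set p"
      let ?k = "card (detour_arcs G s p T)"
      have "finite (set p \<union> T)" using T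
        by (meson Diff_subset List.finite_set finite_UnI finite_arcs finite_subset subset_trans)
      moreover have "set p \<union> T - set p = T" using T by blast
      ultimately have "card {r \<in> ?P. set r \<subseteq> set p \<union> T} \<le> 2 ^ ?k"
        using card_apaths_le[OF p, of "set p \<union> T"] by simp
      then have "?N (set p \<union> T) \<le> 2 ^ ?k"
        using of_nat_mono by fastforce
      \<comment> \<open>The path \<open>p\<close> counts itself, so the denominator is positive and
        \<open>1 / ?N\<close> is not the default value 0.\<close>
      moreover have "p \<in> {r \<in> ?P. set r \<subseteq> set p \<union> T}" using p by simp
      then have "0 < ?N (set p \<union> T)"
        using finite_st_paths by (auto simp: card_gt_0_iff)
      ultimately show "(1 / 2) ^ ?k \<le> 1 / ?N (set p \<union> T)"
        by (simp add: power_one_over frac_le)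
    qed
    finally show "c \<le> subset_mean q (arcs G - set p) (\<lambda>T. 1 / ?N (set p \<union> T))" .
  qed (use q in simp)
  also have "\<dots> = (\<Sum>p\<in>?P. subset_mean q (arcs G) (\<lambda>S. of_bool (set p \<subseteq> S) * (1 / ?N S)))"
    by (intro sum.cong refl subset_mean_superset[symmetric] finite_arcs st_paths_arcs)
  also have "\<dots> = subset_mean q (arcs G) (\<lambda>S. \<Sum>p\<in>?P. of_bool (set p \<subseteq> S) * (1 / ?N S))"
    by (rule subset_mean_sum[symmetric])
  also have "\<dots> = subset_mean q (arcs G) (\<lambda>S. of_bool (\<exists>p\<in>?P. set p \<subseteq> S))"
  proof (rule subset_mean_cong)
    fix S
    have "(\<Sum>p\<in>?P. of_bool (set p \<subseteq> S) * (1 / ?N S)) = (\<Sum>p\<in>?P. of_bool (set p \<subseteq> S)) * (1 / ?N S)"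
      by (rule sum_distrib_right[symmetric])
    also have "(\<Sum>p\<in>?P. of_bool (set p \<subseteq> S)) = ?N S"
      by (simp add: sum_of_bool_eq finite_st_paths Collect_conj_eq)
    also have "?N S * (1 / ?N S) = of_bool (\<exists>p\<in>?P. set p \<subseteq> S)"
      using finite_st_paths by (auto simp: card_eq_0_iff)
    finally show "(\<Sum>p\<in>?P. of_bool (set p \<subseteq> S) * (1 / ?N S)) = of_bool (\<exists>p\<in>?P. set p \<subseteq> S)" .
  qed
  also have "\<dots> = reliability G q s t"
    unfolding reliability_def network_pmf_def
    using q by (subst prob_bernoulli_product_eq_subset_mean) (auto simp: subset_eq)
  finally show ?thesis .
qed

section \<open>Estimates for the random set of detour arcs\<close>

text \<open>The detour arcs are among \<open>T\<close>, and for \<open>T\<close> itself each arc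
  outside \<open>p\<close> contributes a factor of mean \<open>1 - q + q / 2\<close>.\<close>

lemma (in fin_digraph) mean_power_detour_arcs_ge:
  assumes "0 \<le> q" "q \<le> 1" "p \<in> st_paths G s t"
  shows "(1 - q / 2) ^ (card (arcs G) - length p)
    \<le> subset_mean q (arcs G - set p) (\<lambda>T. (1 / 2) ^ card (detour_arcs G s p T))"
proof -
  let ?M = "arcs G - set p"
  have "card ?M = card (arcs G) - length p"
    using st_paths_arcs[OF assms(3)] card_set_st_path[OF assms(3)] by (simp add: card_Diff_subset)
  then have "(1 - q / 2) ^ (card (arcs G) - length p) = subset_mean q ?M (\<lambda>T. (1 / 2) ^ card T)"
    by (simp add: subset_mean_power_card)
  also have "\<dots> \<le> subset_mean q ?M (\<lambda>T. (1 / 2) ^ card (detour_arcs G s p T))"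
  proof (rule subset_mean_mono[OF assms(1,2)])
    fix T assume "T \<subseteq> ?M"
    then have "finite T" by (meson Diff_subset finite_arcs finite_subset subset_trans)
    then show "(1 / 2 :: real) ^ card T \<le> (1 / 2) ^ card (detour_arcs G s p T)"
      by (intro power_decreasing card_mono detour_arcs_subset) auto
  qed
  finally show ?thesis .
qed

text \<open>By independence it suffices, up to a factor \<open>q\<close>, to count arcs with both
  ends in \<open>?U T\<close>. These lie in an induced subgraph whose number of vertices is
  controlled by \<open>card T\<close>, and that has mean \<open>q * card ?M\<close>.\<close>

lemma (in fin_digraph) mean_card_detour_arcs_le:
  assumes q: "0 \<le> q" "q \<le> 1" and p: "p \<in> st_paths G s t"
    and b: "edge_vertex_bound G b" "0 \<le> b"
  shows "subset_mean q (arcs G - set p) (\<lambda>T. real (card (detour_arcs G s p T)))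
    \<le> q * (b * (real (length p) + 1 + q * real (card (arcs G))))"
proof -
  let ?M = "arcs G - set p"
  let ?V = "set (awalk_verts s p)"
  let ?U = "\<lambda>T. ?V \<union> tail G ` T"
  have "subset_mean q ?M (\<lambda>T. real (card (detour_arcs G s p T)))
      \<le> q * subset_mean q ?M (\<lambda>T. real (card {e \<in> ?M. {tail G e, head G e} \<subseteq> ?U T}))"
    unfolding detour_arcs_def
    by (rule subset_mean_card_independent) (use q in auto)
  also have "\<dots> \<le> q * (b * (real (length p) + 1 + q * real (card ?M)))"
  proof (rule mult_left_mono[OF _ q(1)])
    have "subset_mean q ?M (\<lambda>T. real (card {e \<in> ?M. {tail G e, head G e} \<subseteq> ?U T}))
        \<le> subset_mean q ?M (\<lambda>T. b * (real (length p) + 1 + real (card T)))"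
    proof (rule subset_mean_mono[OF q])
      fix T assume T: "T \<subseteq> ?M"
      then have fin: "finite T" by (meson Diff_subset finite_arcs finite_subset subset_trans)
      have "?V \<subseteq> verts G"
        using p by (auto simp: st_paths_def dest!: awalkI_apath elim: awalkE')
      then have U: "?U T \<subseteq> verts G" using T by auto
      have "card {e \<in> ?M. {tail G e, head G e} \<subseteq> ?U T} \<le> card (arcs (G \<restriction> ?U T))"
        by (intro card_mono) auto
      then have "real (card {e \<in> ?M. {tail G e, head G e} \<subseteq> ?U T}) \<le> b * real (card (?U T))"
        using b(1) U unfolding edge_vertex_bound_def by (meson of_nat_mono order_trans)
      \<comment> \<open>The \<open>1\<close> is there because \<open>p\<close> visits one vertex
        more than it has arcs; each arc of \<open>T\<close> adds only its tail.\<close>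
      also have "card (?U T) \<le> length p + 1 + card T"
        using card_Un_le[of ?V "tail G ` T"] card_length[of "awalk_verts s p"]
          card_image_le[OF fin, of "tail G"] by (simp add: length_awalk_verts)
      then have "b * real (card (?U T)) \<le> b * (real (length p) + 1 + real (card T))"
        using b(2) by (intro mult_left_mono) auto
      finally show "real (card {e \<in> ?M. {tail G e, head G e} \<subseteq> ?U T})
          \<le> b * (real (length p) + 1 + real (card T))" .
    qed
    also have "\<dots> = b * (real (length p) + 1 + q * real (card ?M))"
      by (simp only: subset_mean_cmult subset_mean_add subset_mean_const subset_mean_card
          finite_Diff finite_arcs)
    finally show "subset_mean q ?M (\<lambda>T. real (card {e \<in> ?M. {tail G e, head G e} \<subseteq> ?U T}))
      \<le> b * (real (length p) + 1 + q * real (card ?M))" .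
  qed
  also have "\<dots> \<le> q * (b * (real (length p) + 1 + q * real (card (arcs G))))"
    using q b(2) by (intro mult_left_mono add_left_mono) (auto intro: card_mono)
  finally show ?thesis .
qed

text \<open>With \<open>x = q * m\<close> and \<open>L = ln 2\<close>, the product
  \<open>(x + L) * (x + L + l)\<close> is \<open>x * (x + 2 * L + l)\<close> plus the nonnegative
  \<open>L * (L + l)\<close>, and \<open>2 * L\<close> absorbs the summand 1.\<close>

lemma detour_exponent_le:
  fixes q \<mu> m l k :: real
  assumes "0 \<le> q" "0 \<le> \<mu>" "0 < m" "0 \<le> k" "k \<le> l"
  shows "q * (\<mu> * (k + 1 + q * m)) \<le> \<mu> / m * ((q * m + ln 2) * (q * m + ln 2 + l))"
proof -
  let ?L = "ln 2 :: real"
  have L: "1 \<le> 2 * ?L" using ln2_ge_two_thirds by simp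
  have "q * m * (k + 1 + q * m) \<le> q * m * (l + 2 * ?L + q * m)"
    using assms L by (intro mult_left_mono) auto
  also have "\<dots> \<le> (q * m + ?L) * (q * m + ?L + l)"
    using assms by (simp add: algebra_simps)
  finally have "\<mu> / m * (q * m * (k + 1 + q * m)) \<le> \<mu> / m * ((q * m + ?L) * (q * m + ?L + l))"
    using assms by (intro mult_left_mono) auto
  moreover have "\<mu> / m * (q * m * (k + 1 + q * m)) = q * (\<mu> * (k + 1 + q * m))"
    using assms by (simp add: field_simps)
  ultimately show ?thesis by simp
qed

section \<open>The two bounds on the ratio\<close>

theorem theorem5:
  fixes G :: "('a, 'b) pre_digraph" and s t :: 'a and q \<mu> :: real
    and m l_min l_max :: nat
  assumes "fin_digraph G"
    and "acyclic_digraph G"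
    and "s \<in> verts G" and "t \<in> verts G"
    and "0 < q" and "q \<le> 1"
    and "st_paths G s t \<noteq> {}"
    and "edge_vertex_bound G \<mu>"
    and "m = card (arcs G)"
    and "l_min = min_path_length G s t"
    and "l_max = max_path_length G s t"
  shows "path_weight G q s t / reliability G q s t
      \<le> min ((2 / (2 - q)) ^ (m - l_min))
            (2 powr (1 + \<mu> / real m *
               ((q * real m + ln 2) * (q * real m + ln 2 + real l_max))))"
proof -
  interpret fin_digraph G by fact
  let ?P = "st_paths G s t"
  have q: "0 \<le> q" "q \<le> 1" using assms by auto
  have len: "l_min \<le> length p" "length p \<le> l_max" if "p \<in> ?P" for p
    unfolding assms(10,11) min_path_length_def max_path_length_def
    using that finite_st_paths by simp_all
  have W: "0 < path_weight G q s t"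
    unfolding path_weight_def using finite_st_paths assms(5,7) by (intro sum_pos) auto
  \<comment> \<open>Positivity of the reliability comes out of its own lower bound, which makes the
    division sound.\<close>
  have ratio: "path_weight G q s t / reliability G q s t \<le> 1 / c"
    if "0 < c" and "\<And>p. p \<in> ?P \<Longrightarrow>
      c \<le> subset_mean q (arcs G - set p) (\<lambda>T. (1 / 2) ^ card (detour_arcs G s p T))" for c
  proof -
    have le: "c * path_weight G q s t \<le> reliability G q s t"
      by (rule path_weight_le_reliability[OF q that(2)])
    have "0 < c * path_weight G q s t" using that(1) W by simp
    with le have "0 < reliability G q s t" by linarith
    with le that(1) show ?thesis by (simp add: field_simps)
  qed

  have "path_weight G q s t / reliability G q s t \<le> 1 / (1 - q / 2) ^ (m - l_min)"
  proof (rule ratio)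
    fix p assume p: "p \<in> ?P"
    \<comment> \<open>The base is at most 1, so the exponent of a shortest path gives a constant
      valid for all paths.\<close>
    have "(1 - q / 2) ^ (m - l_min) \<le> (1 - q / 2) ^ (m - length p)"
      using len(1)[OF p] q by (intro power_decreasing) auto
    also have "\<dots> \<le> subset_mean q (arcs G - set p) (\<lambda>T. (1 / 2) ^ card (detour_arcs G s p T))"
      unfolding assms(9) by (rule mean_power_detour_arcs_ge[OF q p])
    finally show "(1 - q / 2) ^ (m - l_min)
        \<le> subset_mean q (arcs G - set p) (\<lambda>T. (1 / 2) ^ card (detour_arcs G s p T))" .
  qed (use q in simp)
  also have "1 / (1 - q / 2) ^ (m - l_min) = (1 / (1 - q / 2)) ^ (m - l_min)"
    by (simp add: power_one_over)
  also have "1 / (1 - q / 2) = 2 / (2 - q)"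
    using q by (simp add: field_simps)
  finally have bound1: "path_weight G q s t / reliability G q s t \<le> (2 / (2 - q)) ^ (m - l_min)" .

  define K where
    "K = \<mu> / real m * ((q * real m + ln 2) * (q * real m + ln 2 + real l_max))"
  \<comment> \<open>The subgraph induced by \<open>{s}\<close> has one vertex and a nonnegative
    number of arcs.\<close>
  have "0 \<le> \<mu>"
  proof -
    have "real (card (arcs (G \<restriction> {s}))) \<le> \<mu> * real (card {s})"
      using assms(8)[unfolded edge_vertex_bound_def, rule_format, of "{s}"] assms(3) by simp
    then show ?thesis by (simp add: order_trans[OF of_nat_0_le_iff])
  qed
  have "path_weight G q s t / reliability G q s t \<le> 1 / 2 powr (- K)"
  proof (rule ratio)
    fix p assume p: "p \<in> ?P"
    let ?d = "\<lambda>T. card (detour_arcs G s p T)"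
    have "subset_mean q (arcs G - set p) (\<lambda>T. real (?d T)) \<le> K"
    \<comment> \<open>For \<open>m = 0\<close> division by zero makes \<open>K\<close> equal to 0,
      and there are no arcs to count.\<close>
    proof (cases "m = 0")
      case True
      then have "arcs G = {}" using assms(9) by simp
      then show ?thesis using True by (simp add: K_def detour_arcs_def)
    next
      case False
      have "subset_mean q (arcs G - set p) (\<lambda>T. real (?d T))
          \<le> q * (\<mu> * (real (length p) + 1 + q * real m))"
        unfolding assms(9) by (rule mean_card_detour_arcs_le[OF q p assms(8) \<open>0 \<le> \<mu>\<close>])
      also have "\<dots> \<le> K"
        unfolding K_def using q \<open>0 \<le> \<mu>\<close> False len(2)[OF p] by (intro detour_exponent_le) auto
      finally show ?thesis .
    qed
    then have "2 powr (- K) \<le> 2 powr (- subset_mean q (arcs G - set p) (\<lambda>T. real (?d T)))"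
      by simp
    also have "\<dots> \<le> subset_mean q (arcs G - set p) (\<lambda>T. 2 powr (- real (?d T)))"
      using q by (intro subset_mean_powr_ge) auto
    also have "\<dots> = subset_mean q (arcs G - set p) (\<lambda>T. (1 / 2) ^ ?d T)"
      by (simp add: powr_minus_divide powr_realpow power_one_over)
    finally show "2 powr (- K) \<le> subset_mean q (arcs G - set p) (\<lambda>T. (1 / 2) ^ ?d T)" .
  qed simp
  also have "1 / 2 powr (- K) = 2 powr K" by (simp add: powr_minus_divide)
  also have "\<dots> \<le> 2 powr (1 + K)" by simp
  finally show ?thesis using bound1 by (simp add: K_def)
qed

end
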